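(* Let $\eta^2=-3$ and let $X_\eta=\{a^4+a^2e_2(u_1,\dots,u_5)+e_4(u_1,\dots,u_5)=0\}$ in the hyperplane $L_\eta:\ u_1+\cdots+u_5=\eta a$ of $\mathbb{P}^5$, which is a model of the Burkhardt quartic. The twenty Pascal planes $\Pi_{ij}=\{a+u_i=0,\ a-u_j=0\}\subset L_\eta$, $i\neq j$, $1\le i,j\le 5$, are Jacobi planes on the Burkhardt quartic $X_\eta$.
   Context: We work over $\mathbb{C}$; $e_r$ is the elementary symmetric polynomial of degree $r$, and $a,u_1,\dots,u_5$ are homogeneous coordinates on $\mathbb{P}^5$. The Burkhardt quartic is the quartic threefold $\{\sigma_1(x_0,\dots,x_5)=\sigma_4(x_0,\dots,x_5)=0\}\subset\mathbb{P}^5$ ($\sigma_r$ elementary symmetric polynomials in six variables), up to projective equivalence; it has exactly $45$ singular points, all nodes, and $X_\eta$ is projectively equivalent to it. A Jacobi plane of the Burkhardt quartic is a plane contained in the quartic and containing exactly nine of its $45$ nodes (classically, the planes containing nine nodes are precisely the Jacobi planes, they are contained in the quartic, and there are exactly forty of them). The forty-five nodes of $X_\eta$ are the following points $[a:u_1:\dots:u_5]$ of $L_\eta$. (i) For a partition $\{1,\dots,5\}=A\sqcup B\sqcup\{c\}$ with $|A|=|B|=2$, $R_{A,B;c}$ has $a=1$, $u_i=-1$ for $i\in A$, $u_j=1$ for $j\in B$, $u_c=\eta$. (ii) For $C=\{p,q\}\subset\{1,\dots,5\}$ with $p\ne q$, $T_C$ has $a=0$, $u_i=0$ for $i\notin C$,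 $u_p=1$, $u_q=-1$. (iii) For $c\in\{1,\dots,5\}$, $E_c$ has $a=1$, $u_c=-\eta/3$, $u_i=\eta/3$ for $i\neq c$. *)

theory Defs
  imports "HOL-Analysis.Analysis"
begin

text \<open>
  The projective space P^5 over the complex numbers is the set of lines through the origin in
  \<^typ>\<open>complex^6\<close>. The index type \<^typ>\<open>6\<close> has the elements 0, ..., 5. On the side of
  the standard Burkhardt quartic the coordinates x_0, ..., x_5 are the components 0, ..., 5;
  on the side of X_eta the coordinate a is component 0 and u_1, ..., u_5 are the components
  1, ..., 5. All subspaces, spans and dimensions below are over the complex numbers,
  hence \<open>vec.subspace\<close>, \<open>vec.span\<close>, \<open>vec.dim\<close>
  and not \<open>subspace\<close>, \<open>span\<close>, \<open>dim\<close>.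
\<close>

lemma UNIV_6: "(UNIV::6 set) = {0,1,2,3,4,5}"
proof (rule sym, rule card_subset_eq)
  show "card {0,1,2,3,4,5::6} = card (UNIV::6 set)" by simp
qed auto

lemma atLeastAtMost_1_5: "{1..5} = {1,2,3,4,5::6}"
proof -
  have "x \<in> {1..5} \<longleftrightarrow> x \<in> {1,2,3,4,5}" for x :: 6
  proof -
    have "x \<in> {0,1,2,3,4,5}" using UNIV_6 by blast
    then show ?thesis
      by (auto simp: less_eq_bit0_def bit0.Rep_numeral bit0.Rep_0 bit0.Rep_1)
  qed
  then show ?thesis by blast
qed

type_synonym pt = "(complex^6) set"

definition elem_sym :: "nat \<Rightarrow> 6 set \<Rightarrow> complex^6 \<Rightarrow> complex" where
  "elem_sym r S x = (\<Sum>T | T \<subseteq> S \<and> card T = r. \<Prod>i\<in>T. x $ i)"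

definition proj_locus :: "(complex^6) set \<Rightarrow> pt set" where
  "proj_locus C = {vec.span {x} | x. x \<in> C \<and> x \<noteq> 0}"

definition is_plane :: "pt set \<Rightarrow> bool" where
  "is_plane P \<longleftrightarrow> (\<exists>W. vec.subspace W \<and> vec.dim W = 3 \<and> P = proj_locus W)"

text \<open>
  A quartic threefold is presented by the linear subspace \<open>V\<close> over its ambient
  hyperplane of P^5 and a quartic form \<open>F\<close>, of which only the restriction to \<open>V\<close> matters.
\<close>

definition hypersurface :: "(complex^6) set \<Rightarrow> (complex^6 \<Rightarrow> complex) \<Rightarrow> pt set" where
  "hypersurface V F = proj_locus {x \<in> V. F x = 0}"

definition dir_deriv :: "(complex^6 \<Rightarrow> complex) \<Rightarrow> complex^6 \<Rightarrow> complex^6 \<Rightarrow> complex" where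
  "dir_deriv F v x = deriv (\<lambda>t::complex. F (x + t *s v)) 0"

definition singular_vector :: "(complex^6) set \<Rightarrow> (complex^6 \<Rightarrow> complex) \<Rightarrow> complex^6 \<Rightarrow> bool" where
  "singular_vector V F x \<longleftrightarrow>
     x \<in> V \<and> x \<noteq> 0 \<and> F x = 0 \<and> (\<forall>v\<in>V. dir_deriv F v x = 0)"

text \<open>
  A node is a singular point at which the Hessian of a local equation is nondegenerate.
  The tangent space of P(V) at the point spanned by \<open>x\<close> is the quotient of \<open>V\<close> by that line.
  At a singular point the Hessian form of \<open>F\<close> at \<open>x\<close>, restricted to \<open>V\<close>, has \<open>x\<close> in its
  radical by Euler's relation; the form it induces on the quotient is the Hessian of a local
  equation, so nondegeneracy says that the radical is no larger than the line.
\<close>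

definition nodes :: "(complex^6) set \<Rightarrow> (complex^6 \<Rightarrow> complex) \<Rightarrow> pt set" where
  "nodes V F = {vec.span {x} | x. singular_vector V F x \<and>
     (\<forall>v\<in>V. (\<forall>w\<in>V. dir_deriv (dir_deriv F w) v x = 0) \<longrightarrow> v \<in> vec.span {x})}"

definition burkhardt_space :: "(complex^6) set" where
  "burkhardt_space = {x. elem_sym 1 UNIV x = 0}"

definition burkhardt_form :: "complex^6 \<Rightarrow> complex" where
  "burkhardt_form x = elem_sym 4 UNIV x"

text \<open>
  Projective equivalence of the presented hypersurfaces: a projective linear automorphism of
  P^5 identifies the ambient hyperplanes and carries one quartic equation to a nonzero
  multiple of the other. In particular it identifies both loci and their nodes.
\<close>

definition is_burkhardt_quartic :: "(complex^6) set \<Rightarrow> (complex^6 \<Rightarrow> complex) \<Rightarrow> bool" where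
  "is_burkhardt_quartic V F \<longleftrightarrow>
     (\<exists>(A::complex^6^6) c. invertible A \<and> (\<lambda>x. A *v x) ` V = burkhardt_space \<and>
        c \<noteq> 0 \<and> (\<forall>x\<in>V. burkhardt_form (A *v x) = c * F x))"

definition jacobi_plane :: "(complex^6) set \<Rightarrow> (complex^6 \<Rightarrow> complex) \<Rightarrow> pt set \<Rightarrow> bool" where
  "jacobi_plane V F P \<longleftrightarrow> is_burkhardt_quartic V F \<and>
     is_plane P \<and> P \<subseteq> hypersurface V F \<and> card (P \<inter> nodes V F) = 9"

definition L_space :: "complex \<Rightarrow> (complex^6) set" where
  "L_space \<eta> = {x. (\<Sum>i\<in>{1..5}. x $ i) = \<eta> * x $ 0}"

definition X_form :: "complex^6 \<Rightarrow> complex" where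
  "X_form x = (x $ 0)^4 + (x $ 0)^2 * elem_sym 2 {1..5} x + elem_sym 4 {1..5} x"

definition pascal_plane :: "complex \<Rightarrow> 6 \<Rightarrow> 6 \<Rightarrow> pt set" where
  "pascal_plane \<eta> i j = proj_locus {x \<in> L_space \<eta>. x $ 0 + x $ i = 0 \<and> x $ 0 - x $ j = 0}"

end

theory Submission
  imports Defs
begin

text \<open>
  The substitution \<open>x\<^sub>0 = 2 \<eta> a / 3\<close>, \<open>x\<^sub>i = u\<^sub>i - \<eta> a / 3\<close> carries the equations of \<open>X\<^sub>\<eta>\<close> to
  \<open>\<sigma>\<^sub>1 = \<sigma>\<^sub>4 = 0\<close>. On \<open>\<Pi>\<^sub>i\<^sub>j\<close>, with \<open>p, q, r\<close> the remaining three coordinates and \<open>s\<^sub>n\<close> their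
  elementary symmetric polynomials, the quartic vanishes identically and its derivatives in the
  directions \<open>p, q, r\<close> vanish too, so a point is singular exactly if \<open>a (s\<^sub>2 + a\<^sup>2) = 0\<close> and
  \<open>s\<^sub>3 + a\<^sup>2 s\<^sub>1 = 0\<close>. As \<open>s\<^sub>1 = \<eta> a\<close>, for \<open>a = 0\<close> these are the three points
  \<open>(p, q, r) \<sim> (0, 1, -1)\<close>, and for \<open>a = 1\<close> the polynomial with roots \<open>p, q, r\<close> is
  \<open>(t - \<eta>) (t\<^sup>2 - 1)\<close>, which gives the six permutations of \<open>(\<eta>, 1, -1)\<close>. The Hessian at each of
  these nine points has only the point itself in its radical.
\<close>

section \<open>Elementary symmetric polynomials: recursion on the index set\<close>

lemma elem_sym_0: "finite S \<Longrightarrow> elem_sym 0 S x = 1"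
proof -
  assume "finite S"
  then have "{T. T \<subseteq> S \<and> card T = 0} = {{}}"
    by (auto simp: finite_subset card_eq_0_iff)
  then show ?thesis by (simp add: elem_sym_def)
qed

lemma elem_sym_Suc_empty: "elem_sym (Suc r) {} x = 0"
  unfolding elem_sym_def by (rule sum.neutral) auto

text \<open>The subsets of size \<open>Suc r\<close> either avoid \<open>b\<close> or arise by
  adding \<open>b\<close> to a subset of \<open>S\<close> of size \<open>r\<close>.\<close>

lemma elem_sym_Suc_insert:
  assumes "finite S" "b \<notin> S"
  shows "elem_sym (Suc r) (insert b S) x = elem_sym (Suc r) S x + x $ b * elem_sym r S x"
proof -
  let ?P = "\<lambda>r. {T. T \<subseteq> S \<and> card T = r}"
  have fin: "finite (?P n)" for n
    using assms(1) by simp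
  have nin: "b \<notin> T" "finite T" if "T \<subseteq> S" for T
    using that assms finite_subset by auto
  have split: "{T. T \<subseteq> insert b S \<and> card T = Suc r} = ?P (Suc r) \<union> insert b ` ?P r"
  proof (intro set_eqI iffI)
    fix T assume T: "T \<in> {T. T \<subseteq> insert b S \<and> card T = Suc r}"
    show "T \<in> ?P (Suc r) \<union> insert b ` ?P r"
    proof (cases "b \<in> T")
      case True
      then have "T = insert b (T - {b})" "T - {b} \<subseteq> S" "card (T - {b}) = r"
        using T by auto
      then show ?thesis by blast
    qed (use T in auto)
  qed (use nin in \<open>auto simp: card_insert_if\<close>)
  have inj: "inj_on (insert b) (?P r)"
    using nin by (intro inj_onI) (metis (mono_tags, lifting) Diff_insert_absorb mem_Collect_eq)
  have "elem_sym (Suc r) (insert b S) x =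
      elem_sym (Suc r) S x + (\<Sum>T\<in>insert b ` ?P r. \<Prod>i\<in>T. x $ i)"
    unfolding elem_sym_def split
    by (rule sum.union_disjoint) (use fin nin in auto)
  also have "(\<Sum>T\<in>insert b ` ?P r. \<Prod>i\<in>T. x $ i) = (\<Sum>T\<in>?P r. x $ b * (\<Prod>i\<in>T. x $ i))"
    unfolding sum.reindex[OF inj] by (rule sum.cong) (use nin in auto)
  finally show ?thesis
    by (simp add: elem_sym_def sum_distrib_left)
qed

text \<open>Together with the values on the empty set, these rules let the simplifier expand
  \<open>elem_sym\<close> over an explicitly listed set. Degree one is written \<open>Suc 0\<close>,
  its simp normal form.\<close>

lemma elem_sym_numeral_insert:
  assumes "finite S" "b \<notin> S"
  shows "elem_sym (Suc 0) (insert b S) x = elem_sym (Suc 0) S x + x $ b"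
    and "elem_sym 2 (insert b S) x = elem_sym 2 S x + x $ b * elem_sym (Suc 0) S x"
    and "elem_sym 3 (insert b S) x = elem_sym 3 S x + x $ b * elem_sym 2 S x"
    and "elem_sym 4 (insert b S) x = elem_sym 4 S x + x $ b * elem_sym 3 S x"
  using elem_sym_Suc_insert[OF assms, of 0] elem_sym_Suc_insert[OF assms, of 1]
    elem_sym_Suc_insert[OF assms, of 2] elem_sym_Suc_insert[OF assms, of 3]
  by (simp_all add: elem_sym_0 assms numeral_eq_Suc)

lemma elem_sym_numeral_empty:
  "elem_sym (Suc 0) {} x = 0" "elem_sym 2 {} x = 0" "elem_sym 3 {} x = 0" "elem_sym 4 {} x = 0"
  by (simp_all add: elem_sym_Suc_empty numeral_eq_Suc)

lemmas elem_sym_expand = elem_sym_numeral_insert elem_sym_numeral_empty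

section \<open>First and second directional derivatives\<close>

text \<open>The polynomial is affine in each variable, and the coefficient of \<open>x $ c\<close>
  is the polynomial of one degree less in the other variables. The induction keeps \<open>r\<close>
  arbitrary because inserting an index also calls on the lower degree.\<close>

lemma has_field_derivative_elem_sym:
  assumes "finite S"
  shows "((\<lambda>t. elem_sym (Suc r) S (x + t *s v)) has_field_derivative
      (\<Sum>c\<in>S. v $ c * elem_sym r (S - {c}) x)) (at 0)"
  using assms
proof (induction S arbitrary: r rule: finite_induct)
  case empty
  then show ?case by (simp add: elem_sym_Suc_empty)
next
  case (insert b S)
  have Diff: "insert b S - {c} = insert b (S - {c})" if "c \<in> S" for c
    using that insert.hyps by auto
  show ?case
  proof (cases r)
    case 0
    have "((\<lambda>t. elem_sym 1 S (x + t *s v) + (x $ b + t * v $ b)) has_field_derivative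
        (\<Sum>c\<in>S. v $ c * elem_sym 0 (S - {c}) x) + v $ b) (at 0)"
      using insert.IH[of 0] by (auto intro!: derivative_eq_intros)
    then show ?thesis
      using insert.hyps 0 by (simp add: elem_sym_Suc_insert elem_sym_0 add.commute)
  next
    case (Suc n)
    have "((\<lambda>t. elem_sym (Suc r) S (x + t *s v) + (x $ b + t * v $ b) * elem_sym r S (x + t *s v))
        has_field_derivative (\<Sum>c\<in>S. v $ c * elem_sym r (S - {c}) x) +
          (v $ b * elem_sym r S x + (\<Sum>c\<in>S. v $ c * elem_sym n (S - {c}) x) * x $ b)) (at 0)"
      using insert.IH[of r] insert.IH[of n] Suc by (auto intro!: derivative_eq_intros)
    also have "(\<Sum>c\<in>S. v $ c * elem_sym r (S - {c}) x) +
          (v $ b * elem_sym r S x + (\<Sum>c\<in>S. v $ c * elem_sym n (S - {c}) x) * x $ b) =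
        (\<Sum>c\<in>insert b S. v $ c * elem_sym r (insert b S - {c}) x)"
      using insert.hyps Suc
      by (simp add: Diff elem_sym_Suc_insert sum.distrib sum_distrib_left sum_distrib_right
          algebra_simps)
    finally show ?thesis
      using insert.hyps by (simp add: elem_sym_Suc_insert)
  qed
qed

lemma dir_deriv_X_form:
  "dir_deriv X_form w x =
    w $ 0 * (4 * (x $ 0)^3 + 2 * x $ 0 * elem_sym 2 {1..5} x) +
    (\<Sum>c\<in>{1..5}. w $ c * ((x $ 0)^2 * elem_sym 1 ({1..5} - {c}) x + elem_sym 3 ({1..5} - {c}) x))"
proof -
  have "((\<lambda>t. X_form (x + t *s w)) has_field_derivative
      w $ 0 * (4 * (x $ 0)^3 + 2 * x $ 0 * elem_sym 2 {1..5} x) +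
      ((x $ 0)^2 * (\<Sum>c\<in>{1..5}. w $ c * elem_sym 1 ({1..5} - {c}) x) +
      (\<Sum>c\<in>{1..5}. w $ c * elem_sym 3 ({1..5} - {c}) x))) (at 0)"
    unfolding X_form_def
    using has_field_derivative_elem_sym[of "{1..5}" 1 x w]
      has_field_derivative_elem_sym[of "{1..5}" 3 x w]
    by (auto intro!: derivative_eq_intros simp: numeral_eq_Suc algebra_simps)
  then show ?thesis
    unfolding dir_deriv_def
    by (simp add: DERIV_imp_deriv sum_distrib_left sum.distrib algebra_simps)
qed

text \<open>The gradient formula is differentiated once more. The inner sum omits \<open>c\<close>
  because \<open>X_form\<close> has degree at most one in each \<open>u_c\<close>, so its Hessian
  has no diagonal entries in these variables.\<close>

lemma dir_deriv2_X_form: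
  "dir_deriv (dir_deriv X_form w) v x =
    w $ 0 * (v $ 0 * (12 * (x $ 0)^2 + 2 * elem_sym 2 {1..5} x) +
      2 * x $ 0 * (\<Sum>d\<in>{1..5}. v $ d * elem_sym 1 ({1..5} - {d}) x)) +
    (\<Sum>c\<in>{1..5}. w $ c * (2 * x $ 0 * v $ 0 * elem_sym 1 ({1..5} - {c}) x +
      (\<Sum>d\<in>{1..5} - {c}. v $ d * ((x $ 0)^2 + elem_sym 2 ({1..5} - {c} - {d}) x))))"
proof -
  have e1: "((\<lambda>t. elem_sym 1 ({1..5} - {c}) (x + t *s v)) has_field_derivative
      (\<Sum>d\<in>{1..5} - {c}. v $ d)) (at 0)" for c :: 6
    using has_field_derivative_elem_sym[of "{1..5} - {c}" 0 x v] by (simp add: elem_sym_0)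
  have e2: "((\<lambda>t. elem_sym 2 {1..5} (x + t *s v)) has_field_derivative
      (\<Sum>d\<in>{1..5}. v $ d * elem_sym 1 ({1..5} - {d}) x)) (at 0)"
    using has_field_derivative_elem_sym[of "{1..5}" 1 x v] by (simp add: numeral_eq_Suc)
  have e3: "((\<lambda>t. elem_sym 3 ({1..5} - {c}) (x + t *s v)) has_field_derivative
      (\<Sum>d\<in>{1..5} - {c}. v $ d * elem_sym 2 ({1..5} - {c} - {d}) x)) (at 0)" for c :: 6
    using has_field_derivative_elem_sym[of "{1..5} - {c}" 2 x v] by (simp add: numeral_eq_Suc)
  have "((\<lambda>t. dir_deriv X_form w (x + t *s v)) has_field_derivative
      w $ 0 * (v $ 0 * (12 * (x $ 0)^2 + 2 * elem_sym 2 {1..5} x) +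
        2 * x $ 0 * (\<Sum>d\<in>{1..5}. v $ d * elem_sym 1 ({1..5} - {d}) x)) +
      (\<Sum>c\<in>{1..5}. w $ c * (2 * x $ 0 * v $ 0 * elem_sym 1 ({1..5} - {c}) x +
        (x $ 0)^2 * (\<Sum>d\<in>{1..5} - {c}. v $ d) +
        (\<Sum>d\<in>{1..5} - {c}. v $ d * elem_sym 2 ({1..5} - {c} - {d}) x)))) (at 0)"
    unfolding dir_deriv_X_form
    by (rule derivative_eq_intros e1 e2 e3 refl | simp add: algebra_simps)+
  then show ?thesis
    unfolding dir_deriv_def[of "dir_deriv X_form w"]
    by (simp add: DERIV_imp_deriv sum_distrib_left sum.distrib algebra_simps)
qed

section \<open>Linear subspaces and their projective loci\<close>

lemma span_singleton_cong:
  fixes x y :: "complex^6"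
  assumes "vec.span {x} = vec.span {y}"
  obtains c where "x = c *s y"
  using assms vec.span_base[of x "{x}"] by (auto simp: vec.span_singleton)

text \<open>A subspace is closed under scaling, so it contains every representative of each of its
  points. The zero vector represents no point and is treated apart.\<close>

lemma proj_locus_subset_iff:
  assumes "vec.subspace V" "vec.subspace W"
  shows "proj_locus V \<subseteq> proj_locus W \<longleftrightarrow> V \<subseteq> W"
proof
  assume sub: "proj_locus V \<subseteq> proj_locus W"
  show "V \<subseteq> W"
  proof
    fix x assume x: "x \<in> V"
    show "x \<in> W"
    proof (cases "x = 0")
      case False
      then have "vec.span {x} \<in> proj_locus W"
        using x sub by (auto simp: proj_locus_def)
      then obtain y where "y \<in> W" "vec.span {x} = vec.span {y}"
        by (auto simp: proj_locus_def)
      then show ?thesis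
        by (metis span_singleton_cong vec.subspace_scale assms(2))
    qed (simp add: vec.subspace_0 assms)
  qed
qed (auto simp: proj_locus_def)


section \<open>Nodes in labelled coordinates\<close>

text \<open>The condition inside \<open>nodes (L_space \<eta>) X_form\<close>, stated for a
  representative: that set consists of the spans of these vectors.\<close>

definition node_vector :: "complex \<Rightarrow> complex^6 \<Rightarrow> bool" where
  "node_vector \<eta> x \<longleftrightarrow> singular_vector (L_space \<eta>) X_form x \<and>
     (\<forall>v\<in>L_space \<eta>. (\<forall>w\<in>L_space \<eta>. dir_deriv (dir_deriv X_form w) v x = 0) \<longrightarrow> v \<in> vec.span {x})"

text \<open>Working with an arbitrary labelling of the five indices replaces the symmetric group action
  on the coordinates \<open>u\<^sub>1, \<dots>, u\<^sub>5\<close>.\<close>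

locale labels =
  fixes i j k l m :: 6
  assumes distinct: "distinct [i, j, k, l, m]"
    and indices: "{1..5} = {i, j, k, l, m}"
begin

lemma neq [simp]:
  "i \<noteq> j" "i \<noteq> k" "i \<noteq> l" "i \<noteq> m" "j \<noteq> k" "j \<noteq> l" "j \<noteq> m" "k \<noteq> l" "k \<noteq> m" "l \<noteq> m"
  "j \<noteq> i" "k \<noteq> i" "l \<noteq> i" "m \<noteq> i" "k \<noteq> j" "l \<noteq> j" "m \<noteq> j" "l \<noteq> k" "m \<noteq> k" "m \<noteq> l"
  using distinct by auto

lemma neq_0 [simp]: "i \<noteq> 0" "j \<noteq> 0" "k \<noteq> 0" "l \<noteq> 0" "m \<noteq> 0"
  "0 \<noteq> i" "0 \<noteq> j" "0 \<noteq> k" "0 \<noteq> l" "0 \<noteq> m"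
proof -
  have "(0::6) \<notin> {1..5}" by (simp add: atLeastAtMost_1_5)
  then show "i \<noteq> 0" "j \<noteq> 0" "k \<noteq> 0" "l \<noteq> 0" "m \<noteq> 0"
    "0 \<noteq> i" "0 \<noteq> j" "0 \<noteq> k" "0 \<noteq> l" "0 \<noteq> m" unfolding indices by auto
qed

lemma UNIV_labels: "(UNIV :: 6 set) = {0, i, j, k, l, m}"
  using UNIV_6 atLeastAtMost_1_5 indices by simp

lemma vec_eq_labels: "(x :: complex^6) = y \<longleftrightarrow> x $ 0 = y $ 0 \<and> x $ i = y $ i \<and> x $ j = y $ j \<and>
    x $ k = y $ k \<and> x $ l = y $ l \<and> x $ m = y $ m"
proof -
  have "x = y \<longleftrightarrow> (\<forall>c\<in>UNIV. x $ c = y $ c)" by (simp add: vec_eq_iff)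
  then show ?thesis unfolding UNIV_labels by simp
qed

lemma mem_L_space: "x \<in> L_space \<eta> \<longleftrightarrow> x $ i + x $ j + x $ k + x $ l + x $ m = \<eta> * x $ 0"
  by (simp add: L_space_def indices add.assoc)

section \<open>Projective equivalence with the Burkhardt quartic\<close>

lemma is_burkhardt_quartic_L_space:
  assumes "\<eta>^2 = -3"
  shows "is_burkhardt_quartic (L_space \<eta>) X_form"
proof -
  have \<eta>0: "\<eta> \<noteq> 0" using assms by auto
  \<comment> \<open>The shift by \<open>\<eta> / 3\<close> is the one that cancels the terms a
    e_3(u) in sigma_4. The factor \<open>2 * \<eta> / 3\<close> then turns sigma_1 into u_1 + ... +
    u_5 - \<eta> a. The map \<open>g\<close> is the inverse of \<open>f\<close>.\<close>
  define f where "f = (\<lambda>x::complex^6. \<chi> r. if r = 0 then 2 * \<eta> / 3 * x $ 0 else x $ r - \<eta> / 3 * x $ 0)"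
  define g where "g = (\<lambda>y::complex^6. \<chi> r. if r = 0 then 3 / (2 * \<eta>) * y $ 0 else y $ r + y $ 0 / 2)"
  have lin: "Vector_Spaces.linear (*s) (*s) f" "Vector_Spaces.linear (*s) (*s) g"
    by (unfold_locales; simp add: f_def g_def vec_eq_iff algebra_simps add_divide_distrib)+
  have fg: "f (g y) = y" "g (f y) = y" for y
    using \<eta>0 by (simp_all add: f_def g_def vec_eq_iff)
  have Af: "matrix f *v x = f x" for x
    by (rule matrix_works[OF lin(1)])
  have inv: "invertible (matrix f)"
    using fg lin unfolding invertible_def
    by (metis (no_types, lifting) eq_id_iff matrix_compose_gen matrix_id_mat_1 o_def)
  have f0: "f x $ 0 = 2 * \<eta> / 3 * x $ 0"
    and f1: "r \<noteq> 0 \<Longrightarrow> f x $ r = x $ r - \<eta> / 3 * x $ 0" for x r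
    by (auto simp: f_def)
  have "elem_sym 1 UNIV (f x) = (\<Sum>i\<in>{1..5}. x $ i) - \<eta> * x $ 0" for x
    by (simp add: UNIV_labels indices elem_sym_expand f0 f1)
  then have mem: "f x \<in> burkhardt_space \<longleftrightarrow> x \<in> L_space \<eta>" for x
    by (simp add: burkhardt_space_def L_space_def)
  have image: "f ` L_space \<eta> = burkhardt_space"
  proof
    show "burkhardt_space \<subseteq> f ` L_space \<eta>"
    proof
      fix y assume "y \<in> burkhardt_space"
      then have "g y \<in> L_space \<eta>" using mem[of "g y"] fg by simp
      then show "y \<in> f ` L_space \<eta>" using fg(1)[of y] by (metis imageI)
    qed
  qed (use mem in blast)
  have form: "burkhardt_form (f x) = X_form x" if "x \<in> L_space \<eta>" for x
  proof -
    \<comment> \<open>Eliminating one coordinate by the hyperplane equation leaves a polynomial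
      identity in free variables that holds modulo \<open>\<eta>^2 = -3\<close>.\<close>
    have m: "x $ m = \<eta> * x $ 0 - x $ i - x $ j - x $ k - x $ l"
      using that by (simp add: mem_L_space algebra_simps)
    show ?thesis
      unfolding burkhardt_form_def X_form_def indices UNIV_labels
      by (simp add: elem_sym_expand f0 f1, unfold m, use assms in algebra)
  qed
  show ?thesis
    unfolding is_burkhardt_quartic_def
    by (rule exI[of _ "matrix f"], rule exI[of _ 1]) (use inv image form in \<open>simp add: Af\<close>)
qed

section \<open>The two kinds of nodes that occur on a Pascal plane\<close>

lemmas form_simps = dir_deriv_X_form dir_deriv2_X_form indices elem_sym_expand
  insert_Diff_if axis_def

text \<open>This is the point T_C with C = {l, m}. A vector in the radical of the Hessian must
  vanish at 0, i, j, k, and the hyperplane equation then makes its entries at l and m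
  opposite.\<close>

lemma node_vector_T:
  assumes "x $ 0 = 0" "x $ i = 0" "x $ j = 0" "x $ k = 0" "x $ l = 1" "x $ m = -1"
  shows "node_vector \<eta> x"
proof -
  have "x \<noteq> 0" using assms by auto
  moreover have "x \<in> L_space \<eta>" using assms by (simp add: mem_L_space)
  moreover have "X_form x = 0" using assms by (simp add: X_form_def form_simps)
  moreover have "dir_deriv X_form w x = 0" for w
    using assms by (simp add: form_simps)
  moreover have "v \<in> vec.span {x}"
    if v: "v \<in> L_space \<eta>" and H: "\<forall>w\<in>L_space \<eta>. dir_deriv (dir_deriv X_form w) v x = 0" for v
  proof -
    have "dir_deriv (dir_deriv X_form w) v x = - (2 * w $ 0 * v $ 0 + w $ i * (v $ j + v $ k) +
        w $ j * (v $ i + v $ k) + w $ k * (v $ i + v $ j))" for w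
      using assms by (simp add: form_simps algebra_simps)
    then have H': "2 * w $ 0 * v $ 0 + w $ i * (v $ j + v $ k) + w $ j * (v $ i + v $ k) +
        w $ k * (v $ i + v $ j) = 0" if "w \<in> L_space \<eta>" for w
      using H that by (metis neg_equal_0_iff_equal)
    \<comment> \<open>The \<open>axis l\<close> summands put the test vectors into
      \<open>L_space \<eta>\<close>. They do not affect the values, since the Hessian involves
      neither \<open>w $ l\<close> nor \<open>w $ m\<close>.\<close>
    have "v $ 0 = 0" "v $ j + v $ k = 0" "v $ i + v $ k = 0" "v $ i + v $ j = 0"
      using H'[of "axis 0 1 + axis l \<eta>"] H'[of "axis i 1 - axis l 1"]
        H'[of "axis j 1 - axis l 1"] H'[of "axis k 1 - axis l 1"]
      by (simp_all add: axis_def mem_L_space)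
    then have "v = v $ l *s x"
      using v assms unfolding mem_L_space vec_eq_labels by simp algebra
    then show ?thesis by (auto simp: vec.span_singleton)
  qed
  ultimately show ?thesis by (simp add: node_vector_def singular_vector_def)
qed

text \<open>This is the point R_{A,B;c} with A = {i, k}, B = {j, l}, c = m. The Hessian equations
  fix the entries of \<open>v\<close> at i, j, k, l in terms of \<open>v $ 0\<close>, and the
  hyperplane equation fixes the one at m.\<close>

lemma node_vector_R:
  assumes \<eta>: "\<eta>^2 = -3"
    and "x $ 0 = 1" "x $ i = -1" "x $ j = 1" "x $ k = -1" "x $ l = 1" "x $ m = \<eta>"
  shows "node_vector \<eta> x"
proof -
  have \<eta>': "\<eta> * \<eta> = -3" "\<And>z. \<eta> * (\<eta> * z) = -3 * z"
    using \<eta> by (simp_all add: power2_eq_square mult.assoc[symmetric])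
  have "x \<noteq> 0" using assms by auto
  moreover have "x \<in> L_space \<eta>" using assms by (simp add: mem_L_space)
  moreover have "X_form x = 0" using assms by (simp add: X_form_def form_simps)
  moreover have "dir_deriv X_form w x = 0" if "w \<in> L_space \<eta>" for w
    using assms that by (simp add: form_simps \<eta>' algebra_simps)
  moreover have "v \<in> vec.span {x}"
    if v: "v \<in> L_space \<eta>" and H: "\<forall>w\<in>L_space \<eta>. dir_deriv (dir_deriv X_form w) v x = 0" for v
  proof -
    have H': "w \<in> L_space \<eta> \<Longrightarrow> dir_deriv (dir_deriv X_form w) v x = 0" for w
      using H by blast
    have D: "dir_deriv (dir_deriv X_form w) v x = 2 * (4 * w $ 0 * v $ 0 +
        w $ 0 * ((\<eta> + 1) * (v $ i + v $ k) + (\<eta> - 1) * (v $ j + v $ l)) +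
        v $ 0 * ((\<eta> + 1) * (w $ i + w $ k) + (\<eta> - 1) * (w $ j + w $ l)) +
        (1 + \<eta>) * (w $ i * v $ k + w $ k * v $ i) +
        (1 - \<eta>) * (w $ j * v $ l + w $ l * v $ j))" for w
      using assms by (simp add: form_simps algebra_simps)
    \<comment> \<open>The form \<open>D\<close> does not involve \<open>w $ m\<close>, so
      subtracting \<open>axis m 1\<close> only puts the test vector into the hyperplane. Each choice
      of \<open>c\<close> yields an equation between \<open>v $ 0\<close> and one other
      entry.\<close>
    have "dir_deriv (dir_deriv X_form (axis c 1 - axis m 1)) v x = 0" if "c \<in> {i, j, k, l}" for c
      using H that by (auto simp: mem_L_space axis_def)
    moreover have "dir_deriv (dir_deriv X_form (axis i 1 - axis m 1)) v x = 2 * ((1 + \<eta>) * (v $ 0 + v $ k))"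
      "dir_deriv (dir_deriv X_form (axis j 1 - axis m 1)) v x = 2 * ((1 - \<eta>) * (v $ l - v $ 0))"
      "dir_deriv (dir_deriv X_form (axis k 1 - axis m 1)) v x = 2 * ((1 + \<eta>) * (v $ 0 + v $ i))"
      "dir_deriv (dir_deriv X_form (axis l 1 - axis m 1)) v x = 2 * ((1 - \<eta>) * (v $ j - v $ 0))"
      unfolding D by (simp_all add: axis_def algebra_simps)
    ultimately have "(1 + \<eta>) * (v $ 0 + v $ k) = 0" "(1 - \<eta>) * (v $ l - v $ 0) = 0"
      "(1 + \<eta>) * (v $ 0 + v $ i) = 0" "(1 - \<eta>) * (v $ j - v $ 0) = 0"
      by auto
    moreover have "1 + \<eta> \<noteq> 0" "1 - \<eta> \<noteq> 0"
      using \<eta> by (auto simp: add_eq_0_iff)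
    ultimately have "v $ k = - v $ 0" "v $ l = v $ 0" "v $ i = - v $ 0" "v $ j = v $ 0"
      by (simp_all add: add_eq_0_iff)
    then have "v = v $ 0 *s x"
      using v assms by (simp add: mem_L_space vec_eq_labels mult.commute)
    then show ?thesis by (auto simp: vec.span_singleton)
  qed
  ultimately show ?thesis by (simp add: node_vector_def singular_vector_def)
qed


section \<open>The Pascal plane as a three-dimensional subspace\<close>

definition plane_space :: "complex \<Rightarrow> (complex^6) set" where
  "plane_space \<eta> = {x \<in> L_space \<eta>. x $ 0 + x $ i = 0 \<and> x $ 0 - x $ j = 0}"

lemma mem_plane_space: "x \<in> plane_space \<eta> \<longleftrightarrow>
    x $ i = - x $ 0 \<and> x $ j = x $ 0 \<and> x $ k + x $ l + x $ m = \<eta> * x $ 0"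
  by (auto simp: plane_space_def mem_L_space add_eq_0_iff)

lemma subspace_plane_space: "vec.subspace (plane_space \<eta>)"
  by (auto simp: vec.subspace_def mem_plane_space algebra_simps) (simp flip: distrib_left)

text \<open>The entries at k, l, m are free here; the vector lies in
  \<open>plane_space \<eta>\<close> exactly if p + q + r = \<eta> a. Taking a quadruple as argument
  allows the nodes to be listed as a finite set of parameters.\<close>

definition plane_vector :: "complex \<times> complex \<times> complex \<times> complex \<Rightarrow> complex^6" where
  "plane_vector = (\<lambda>(a, p, q, r). \<chi> c. if c = 0 \<or> c = j then a else if c = i then - a
     else if c = k then p else if c = l then q else r)"

lemma plane_vector_nth [simp]:
  "plane_vector (a, p, q, r) $ 0 = a" "plane_vector (a, p, q, r) $ i = - a"
  "plane_vector (a, p, q, r) $ j = a" "plane_vector (a, p, q, r) $ k = p"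
  "plane_vector (a, p, q, r) $ l = q" "plane_vector (a, p, q, r) $ m = r"
  by (simp_all add: plane_vector_def)

lemma dim_plane_space: "vec.dim (plane_space \<eta>) = 3"
proof -
  \<comment> \<open>Free coordinates are those at 0, k, l; the entry at m is solved from p + q + r =
    \<eta> a.\<close>
  define B where "B = {plane_vector (1, 0, 0, \<eta>), plane_vector (0, 1, 0, -1), plane_vector (0, 0, 1, -1)}"
  have B: "B \<subseteq> plane_space \<eta>" by (auto simp: B_def mem_plane_space)
  moreover have "plane_space \<eta> \<subseteq> vec.span B"
  proof
    fix x assume "x \<in> plane_space \<eta>"
    then have "x = x $ 0 *s plane_vector (1, 0, 0, \<eta>) + x $ k *s plane_vector (0, 1, 0, -1)
        + x $ l *s plane_vector (0, 0, 1, -1)"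
      by (simp add: mem_plane_space vec_eq_labels algebra_simps)
    also have "\<dots> \<in> vec.span B"
      by (intro vec.span_add vec.span_scale vec.span_base) (simp_all add: B_def)
    finally show "x \<in> vec.span B" .
  qed
  moreover have "vec.independent B"
    unfolding B_def
    by (auto simp: vec.independent_insert vec.span_insert vec.span_singleton vec_eq_labels)
  moreover have "card B = 3"
    by (simp add: B_def vec_eq_labels)
  ultimately show ?thesis by (metis vec.dim_unique)
qed

text \<open>As (1 - a t)(1 + a t) = 1 - a^2 t^2, the entries -a and a give e_2 = s_2 - a^2 and e_4 =
  -a^2 s_2, where s_2 belongs to the other three entries. The three terms of the quartic then
  cancel.\<close>

lemma X_form_plane_space: "x \<in> plane_space \<eta> \<Longrightarrow> X_form x = 0"
  by (simp add: mem_plane_space X_form_def form_simps algebra_simps power4_eq_xxxx power2_eq_square)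

section \<open>The nine nodes on the plane\<close>

text \<open>The first three are the points T_C with C inside {k, l, m}. The other six are the points
  R_{A,B;c} with i in A and j in B, where c is the position of \<open>\<eta>\<close>.\<close>

definition node_params :: "complex \<Rightarrow> (complex \<times> complex \<times> complex \<times> complex) set" where
  "node_params \<eta> = {(0, 0, 1, -1), (0, 1, 0, -1), (0, 1, -1, 0),
     (1, \<eta>, 1, -1), (1, \<eta>, -1, 1), (1, 1, \<eta>, -1), (1, -1, \<eta>, 1), (1, 1, -1, \<eta>), (1, -1, 1, \<eta>)}"

text \<open>Each quadruple has 1 as its first nonzero entry, so proportional vectors among these are
  equal. The quadruples themselves differ because \<open>\<eta>\<close> is neither 1 nor -1.\<close>

lemma card_node_points:
  assumes "\<eta>^2 = -3"
  shows "card ((\<lambda>t. vec.span {plane_vector t}) ` node_params \<eta>) = 9"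
proof -
  have \<eta>: "\<eta> \<noteq> 0" "\<eta> \<noteq> 1" "\<eta> \<noteq> -1" "1 \<noteq> \<eta>" "-1 \<noteq> \<eta>" "0 \<noteq> \<eta>"
    using assms by auto
  have "inj_on (\<lambda>t. vec.span {plane_vector t}) (node_params \<eta>)"
  proof (rule inj_onI)
    fix s t assume st: "s \<in> node_params \<eta>" "t \<in> node_params \<eta>"
      and "vec.span {plane_vector s} = vec.span {plane_vector t}"
    then obtain c where c: "plane_vector s = c *s plane_vector t"
      using span_singleton_cong by blast
    then show "s = t"
      using st \<eta> unfolding node_params_def vec_eq_labels by auto
  qed
  then have "card ((\<lambda>t. vec.span {plane_vector t}) ` node_params \<eta>) = card (node_params \<eta>)"
    by (rule card_image)
  also have "\<dots> = 9" using \<eta> by (simp add: node_params_def)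
  finally show ?thesis .
qed

text \<open>The five nontrivial permutations of the labels k, l, m, which leave the plane
  unchanged.\<close>

lemma labels_permute:
  "labels i j l k m" "labels i j k m l" "labels i j m l k" "labels i j l m k" "labels i j m k l"
  using distinct indices by (auto simp: labels_def)

lemma node_vector_plane_vector:
  assumes \<eta>: "\<eta>^2 = -3" and "t \<in> node_params \<eta>"
  shows "node_vector \<eta> (plane_vector t)"
proof -
  \<comment> \<open>\<open>node_vector\<close> does not mention labels. For each point the labelling
    is chosen so that its last three entries read 0, 1, -1 or -1, 1, \<open>\<eta>\<close>.\<close>
  note T = labels.node_vector_T[where \<eta> = \<eta>] and R = labels.node_vector_R[OF _ \<eta>]
  have "node_vector \<eta> (plane_vector (0, 0, 1, -1))" by (rule node_vector_T) auto
  moreover have "node_vector \<eta> (plane_vector (0, 1, 0, -1))"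
    by (rule T[OF labels_permute(1)]) auto
  moreover have "node_vector \<eta> (plane_vector (0, 1, -1, 0))"
    by (rule T[OF labels_permute(5)]) auto
  moreover have "node_vector \<eta> (plane_vector (1, \<eta>, 1, -1))"
    by (rule R[OF labels_permute(3)]) auto
  moreover have "node_vector \<eta> (plane_vector (1, \<eta>, -1, 1))"
    by (rule R[OF labels_permute(4)]) auto
  moreover have "node_vector \<eta> (plane_vector (1, 1, \<eta>, -1))"
    by (rule R[OF labels_permute(5)]) auto
  moreover have "node_vector \<eta> (plane_vector (1, -1, \<eta>, 1))"
    by (rule R[OF labels_permute(2)]) auto
  moreover have "node_vector \<eta> (plane_vector (1, 1, -1, \<eta>))"
    by (rule R[OF labels_permute(1)]) auto
  moreover have "node_vector \<eta> (plane_vector (1, -1, 1, \<eta>))"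
    by (rule node_vector_R[OF \<eta>]) auto
  ultimately show ?thesis using assms(2) unfolding node_params_def by blast
qed

text \<open>Converse direction: two derivatives along the hyperplane, transversal to the plane,
  already confine a singular point to the list.\<close>

lemma singular_plane_space:
  assumes "singular_vector (L_space \<eta>) X_form x" "x \<in> plane_space \<eta>"
  shows "vec.span {x} \<in> (\<lambda>t. vec.span {plane_vector t}) ` node_params \<eta>"
proof -
  obtain a p q r where x: "x $ 0 = a" "x $ i = -a" "x $ j = a" "x $ k = p" "x $ l = q" "x $ m = r"
    and s1: "p + q + r = \<eta> * a"
    using assms(2) by (simp add: mem_plane_space)
  have *: ?thesis if "t \<in> node_params \<eta>" "x = c *s plane_vector t" for c t
  proof -
    have "c \<noteq> 0" using assms(1) that(2) by (auto simp: singular_vector_def)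
    then have "plane_vector t = inverse c *s x" using that(2) by simp
    then have "vec.span {x} = vec.span {plane_vector t}"
      using that(2) unfolding vec.span_eq by (auto simp: vec.span_singleton)
    then show ?thesis using that(1) by auto
  qed
  have "dir_deriv X_form (axis i 1 - axis k 1) x = 0" "dir_deriv X_form (axis j 1 - axis k 1) x = 0"
    using assms(1) by (auto simp: singular_vector_def mem_L_space axis_def)
  moreover have
    "dir_deriv X_form (axis i 1 - axis k 1) x =
      a^2 * (p + q + r) + a^3 + p * q * r + a * (p * q + p * r + q * r)"
    "dir_deriv X_form (axis j 1 - axis k 1) x =
      a^2 * (p + q + r) - a^3 + p * q * r - a * (p * q + p * r + q * r)"
    using x by (simp_all add: form_simps algebra_simps power2_eq_square power3_eq_cube)
  ultimately have "a^2 * (p + q + r) + a^3 + p * q * r + a * (p * q + p * r + q * r) = 0"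
      "a^2 * (p + q + r) - a^3 + p * q * r - a * (p * q + p * r + q * r) = 0"
    by simp_all
  \<comment> \<open>Half the sum and half the difference of the two equations.\<close>
  then have s3: "p * q * r + a^2 * (p + q + r) = 0" and s2: "a * (p * q + p * r + q * r + a^2) = 0"
    by algebra+
  show ?thesis
  proof (cases "a = 0")
    case True
    \<comment> \<open>Here s_1 = s_3 = 0: one of the three entries vanishes and the other two are
      opposite.\<close>
    then consider "p = 0" "r = - q" | "q = 0" "r = - p" | "r = 0" "q = - p"
      using s1 s3 by (auto simp: add_eq_0_iff)
    then show ?thesis
    proof cases
      case 1
      then show ?thesis using x True
        by (intro *[of "(0, 0, 1, -1)" q]) (simp_all add: node_params_def vec_eq_labels)
    next
      case 2
      then show ?thesis using x True
        by (intro *[of "(0, 1, 0, -1)" p]) (simp_all add: node_params_def vec_eq_labels)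
    next
      case 3
      then show ?thesis using x True
        by (intro *[of "(0, 1, -1, 0)" p]) (simp_all add: node_params_def vec_eq_labels)
    qed
  next
    case False
    then have s2': "p * q + p * r + q * r = - (a^2)"
      using s2 by (simp add: add_eq_0_iff)
    have split: "y = a \<and> z = - a \<or> y = - a \<and> z = a" if "y + z = 0" "y * z = - (a^2)" for y z
    proof -
      have z: "z = - y" using that(1) by (simp add: add_eq_0_iff)
      then have "y^2 = a^2" using that(2) by (simp add: power2_eq_square)
      then show ?thesis using z by (auto simp: power2_eq_iff)
    qed
    \<comment> \<open>Up to sign this is t^3 - s_1 t^2 + s_2 t - s_3 at t = \<eta> a. The first two
      terms cancel by s_1 = \<eta> a, the last two by s_2 = -a^2 and s_3 = -a^2 s_1.\<close>
    have "(p - \<eta> * a) * (q - \<eta> * a) * (r - \<eta> * a) = 0"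
      using s1 s2' s3 by algebra
    then consider "p = \<eta> * a" | "q = \<eta> * a" | "r = \<eta> * a" by auto
    then show ?thesis
    proof cases
      case 1
      \<comment> \<open>With one root equal to \<eta> a, the other two have sum 0 and product -a^2,
        hence are a and -a in some order.\<close>
      have "q + r = 0" using s1 1 by simp
      moreover from this have "q * r = - (a^2)" using s2' by algebra
      ultimately consider "q = a" "r = - a" | "q = - a" "r = a" using split by blast
      then show ?thesis
      proof cases
        case 1
        then show ?thesis using x \<open>p = \<eta> * a\<close>
          by (intro *[of "(1, \<eta>, 1, -1)" a]) (simp_all add: node_params_def vec_eq_labels)
      next
        case 2
        then show ?thesis using x \<open>p = \<eta> * a\<close>
          by (intro *[of "(1, \<eta>, -1, 1)" a]) (simp_all add: node_params_def vec_eq_labels)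
      qed
    next
      case 2
      have "p + r = 0" using s1 2 by (simp add: algebra_simps)
      moreover from this have "p * r = - (a^2)" using s2' by algebra
      ultimately consider "p = a" "r = - a" | "p = - a" "r = a" using split by blast
      then show ?thesis
      proof cases
        case 1
        then show ?thesis using x \<open>q = \<eta> * a\<close>
          by (intro *[of "(1, 1, \<eta>, -1)" a]) (simp_all add: node_params_def vec_eq_labels)
      next
        case 2
        then show ?thesis using x \<open>q = \<eta> * a\<close>
          by (intro *[of "(1, -1, \<eta>, 1)" a]) (simp_all add: node_params_def vec_eq_labels)
      qed
    next
      case 3
      have "p + q = 0" using s1 3 by simp
      moreover from this have "p * q = - (a^2)" using s2' by algebra
      ultimately consider "p = a" "q = - a" | "p = - a" "q = a" using split by blast
      then show ?thesis
      proof cases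
        case 1
        then show ?thesis using x \<open>r = \<eta> * a\<close>
          by (intro *[of "(1, 1, -1, \<eta>)" a]) (simp_all add: node_params_def vec_eq_labels)
      next
        case 2
        then show ?thesis using x \<open>r = \<eta> * a\<close>
          by (intro *[of "(1, -1, 1, \<eta>)" a]) (simp_all add: node_params_def vec_eq_labels)
      qed
    qed
  qed
qed

lemma pascal_plane_eq: "pascal_plane \<eta> i j = proj_locus (plane_space \<eta>)"
  by (simp add: pascal_plane_def plane_space_def)

lemma pascal_plane_nodes:
  assumes "\<eta>^2 = -3"
  shows "pascal_plane \<eta> i j \<inter> nodes (L_space \<eta>) X_form =
    (\<lambda>t. vec.span {plane_vector t}) ` node_params \<eta>" (is "?P \<inter> ?N = ?S")
proof
  show "?P \<inter> ?N \<subseteq> ?S"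
  proof
    fix z assume z: "z \<in> ?P \<inter> ?N"
    then obtain x y where "z = vec.span {x}" "x \<in> plane_space \<eta>"
      and y: "z = vec.span {y}" "singular_vector (L_space \<eta>) X_form y"
      by (auto simp: pascal_plane_eq proj_locus_def nodes_def)
    \<comment> \<open>The representative known to be singular need not be the one known to lie in
      the plane; they differ by a scalar.\<close>
    then have "y \<in> plane_space \<eta>"
      by (metis span_singleton_cong vec.subspace_scale subspace_plane_space)
    then show "z \<in> ?S" using singular_plane_space y by simp
  qed
  show "?S \<subseteq> ?P \<inter> ?N"
  proof (rule image_subsetI)
    fix t assume t: "t \<in> node_params \<eta>"
    have n: "node_vector \<eta> (plane_vector t)"
      using node_vector_plane_vector[OF assms t] .
    have "plane_vector t \<in> plane_space \<eta>"
      using t by (auto simp: node_params_def mem_plane_space)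
    moreover have "plane_vector t \<noteq> 0"
      using n by (simp add: node_vector_def singular_vector_def)
    ultimately have "vec.span {plane_vector t} \<in> ?P"
      by (auto simp: pascal_plane_eq proj_locus_def)
    moreover have "vec.span {plane_vector t} \<in> ?N"
      using n by (auto simp: nodes_def node_vector_def)
    ultimately show "vec.span {plane_vector t} \<in> ?P \<inter> ?N" by blast
  qed
qed

lemma jacobi_plane_pascal_plane:
  assumes "\<eta>^2 = -3"
  shows "jacobi_plane (L_space \<eta>) X_form (pascal_plane \<eta> i j)"
proof -
  have "pascal_plane \<eta> i j \<subseteq> hypersurface (L_space \<eta>) X_form"
    using X_form_plane_space
    by (auto simp: pascal_plane_eq hypersurface_def proj_locus_def plane_space_def)
  moreover have "is_plane (pascal_plane \<eta> i j)"
    unfolding is_plane_def pascal_plane_eq using subspace_plane_space dim_plane_space by blast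
  ultimately show ?thesis
    using assms by (simp add: jacobi_plane_def is_burkhardt_quartic_L_space pascal_plane_nodes
        card_node_points)
qed

text \<open>The vector with \<open>p = q = r = \<eta> / 3\<close> has \<open>- 1\<close> only in position \<open>i\<close> and \<open>1\<close> only in position
  \<open>j\<close>, so the plane remembers both labels.\<close>

lemma pascal_plane_subset:
  assumes \<eta>: "\<eta>^2 = -3" and "labels i' j' k' l' m'"
    and "pascal_plane \<eta> i j \<subseteq> pascal_plane \<eta> i' j'"
  shows "i' = i \<and> j' = j"
proof -
  interpret L: labels i' j' k' l' m' by fact
  have "\<eta> \<noteq> 3" "\<eta> \<noteq> -3" using \<eta> by auto
  then have ne: "\<eta> / 3 \<noteq> 1" "\<eta> / 3 \<noteq> -1" by (auto simp: field_simps)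
  define x where "x = plane_vector (1, \<eta> / 3, \<eta> / 3, \<eta> / 3)"
  have "x \<in> plane_space \<eta>" by (simp add: x_def mem_plane_space)
  then have "x \<in> L.plane_space \<eta>"
    using assms(3) proj_locus_subset_iff[OF subspace_plane_space L.subspace_plane_space]
    by (auto simp: pascal_plane_eq L.pascal_plane_eq)
  then have "x $ i' = -1" "x $ j' = 1"
    by (simp_all add: L.mem_plane_space x_def)
  moreover have "i' \<in> {i, j, k, l, m}" "j' \<in> {i, j, k, l, m}"
    using L.indices indices by blast+
  ultimately show ?thesis
    using ne unfolding x_def by (elim insertE emptyE) simp_all
qed

end

section \<open>Counting the planes over all ordered pairs\<close>

text \<open>Carries the results of the locale over to an arbitrary ordered pair of distinct
  indices.\<close>

lemma labels_exist:
  fixes i j :: 6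
  assumes "i \<in> {1..5}" "j \<in> {1..5}" "i \<noteq> j"
  obtains k l m where "labels i j k l m"
proof -
  have "card {1..5::6} = 5" by (simp add: atLeastAtMost_1_5)
  moreover have sub: "{i, j} \<subseteq> {1..5}" using assms by blast
  ultimately have "card ({1..5} - {i, j}) = 3"
    using assms(3) card_Diff_subset[OF _ sub] by (simp del: atLeastAtMost_iff)
  then obtain k l m where klm: "{1..5} - {i, j} = {k, l, m}" "k \<noteq> l" "l \<noteq> m" "k \<noteq> m"
    unfolding card_3_iff by blast
  then have "{1..5} = {i, j} \<union> {k, l, m}" using sub by (metis Diff_partition)
  moreover have "distinct [i, j, k, l, m]"
    using klm(2-4) assms(3) klm(1)[symmetric] by (simp del: atLeastAtMost_iff)
  ultimately have "labels i j k l m" by (simp add: labels_def insert_commute)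
  then show ?thesis by (rule that)
qed

theorem corollary5p2:
  fixes \<eta> :: complex
  assumes "\<eta>^2 = -3"
  shows "card {pascal_plane \<eta> i j | i j. i \<in> {1..5} \<and> j \<in> {1..5} \<and> i \<noteq> j} = 20 \<and>
    (\<forall>i\<in>{1..5}. \<forall>j\<in>{1..5}. i \<noteq> j \<longrightarrow>
       jacobi_plane (L_space \<eta>) X_form (pascal_plane \<eta> i j))"
proof
  \<comment> \<open>There are 25 - 5 = 20 off-diagonal pairs, so it remains to see that distinct
    pairs give distinct planes.\<close>
  define D where "D = {1..5::6} \<times> {1..5} - (\<lambda>i. (i, i)) ` {1..5}"
  have D: "(i, j) \<in> D \<longleftrightarrow> i \<in> {1..5} \<and> j \<in> {1..5} \<and> i \<noteq> j" for i j
    by (auto simp: D_def)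
  have "inj_on (\<lambda>(i, j). pascal_plane \<eta> i j) D"
  proof (rule inj_onI, clarify)
    fix i j i' j'
    assume "(i, j) \<in> D" "(i', j') \<in> D" and eq: "pascal_plane \<eta> i j = pascal_plane \<eta> i' j'"
    then obtain k l m k' l' m' where "labels i j k l m" "labels i' j' k' l' m'"
      by (metis D labels_exist)
    then show "i = i' \<and> j = j'"
      using labels.pascal_plane_subset assms eq by blast
  qed
  then have "card ((\<lambda>(i, j). pascal_plane \<eta> i j) ` D) = card D"
    by (rule card_image)
  also have "card D = 20"
    unfolding D_def
    by (subst card_Diff_subset)
      (auto simp: card_cartesian_product card_image inj_on_def atLeastAtMost_1_5)
  also have "(\<lambda>(i, j). pascal_plane \<eta> i j) ` D =
      {pascal_plane \<eta> i j | i j. i \<in> {1..5} \<and> j \<in> {1..5} \<and> i \<noteq> j}"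
    using D by (auto simp: image_iff) (metis case_prod_conv)
  finally show "card {pascal_plane \<eta> i j | i j. i \<in> {1..5} \<and> j \<in> {1..5} \<and> i \<noteq> j} = 20" .
  show "\<forall>i\<in>{1..5}. \<forall>j\<in>{1..5}. i \<noteq> j \<longrightarrow> jacobi_plane (L_space \<eta>) X_form (pascal_plane \<eta> i j)"
    by (metis assms labels_exist labels.jacobi_plane_pascal_plane)
qed

end
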